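(* Let $(V,\alpha,\beta,\odot_V,\varepsilon,i,V_0)$ be a generalized vector groupoid over a field $K$, let $X$ be a vector space over $K$, let $h:X\to V_0$ be a $K$-linear map, let $(h^*(V),X)$ be the induced vector groupoid of $(V,V_0)$ by $h$, and let $(h_V^*,h):(h^*(V),X)\to(V,V_0)$, $h_V^*(x,y,a)=a$, be the canonical vector groupoid morphism. Then for every generalized vector groupoid $(V',\alpha',\beta',\odot_{V'},\varepsilon',i',X)$ over $K$ with base $X$ and every vector groupoid morphism $(u,h):(V',X)\to(V,V_0)$, there exists a unique $X$-morphism of vector groupoids $v:V'\to h^*(V)$ such that $h_V^*\circ v=u$.
   Context: Ehresmann groupoid: a groupoid $(G,\alpha,\beta,m,\varepsilon,i,G_0)$ consists of sets $G,G_0$, surjective maps $\alpha,\beta:G\to G_0$ (source, target), a partial multiplication $m:G_{(2)}\to G$, $(x,y)\mapsto x\cdot y$, where $G_{(2)}=\{(x,y)\in G\times G\mid \beta(x)=\alpha(y)\}$, an injective map $\varepsilon:G_0\to G$ (inclusion) and a map $i:G\to G$, $i(x)=x^{-1}$ (inversion), such that: (G1) $(x\cdot y)\cdot z=x\cdot(y\cdot z)$, in the sense that if one of the two products is defined, then so is the other and they are equal; (G2) for each $x\in G$: $(\varepsilon(\alpha(x)),x)\in G_{(2)}$, $(x,\varepsilon(\beta(x)))\in G_{(2)}$ and $\varepsilon(\alpha(x))\cdot x=x=x\cdot\varepsilon(\beta(x))$; (G3) for each $x\in G$: $(x^{-1},x)\in G_{(2)}$, $(x,x^{-1})\in G_{(2)}$,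 $x^{-1}\cdot x=\varepsilon(\beta(x))$ and $x\cdot x^{-1}=\varepsilon(\alpha(x))$. Generalized vector groupoid over a field $K$: an Ehresmann groupoid $(V,\alpha,\beta,\odot,\varepsilon,i,V_0)$ such that $V$ and $V_0$ are vector spaces over $K$; $\alpha,\beta:V\to V_0$ are linear; $\varepsilon:V_0\to V$ and $i:V\to V$ are linear, and $x+x^{-1}=\varepsilon(\alpha(x))+\varepsilon(\beta(x))$ for all $x\in V$; and the multiplication satisfies: (1) $x\odot(y+z-\varepsilon(\beta(x)))=x\odot y+x\odot z-x$ for all $x,y,z\in V$ with $\alpha(y)=\beta(x)=\alpha(z)$; (2) $x\odot(ky+(1-k)\varepsilon(\beta(x)))=k(x\odot y)+(1-k)x$ for all $k\in K$ and $x,y\in V$ with $\alpha(y)=\beta(x)$; (3) $(y+z-\varepsilon(\alpha(x)))\odot x=y\odot x+z\odot x-x$ for all $x,y,z\in V$ with $\alpha(x)=\beta(y)=\beta(z)$; (4) $(ky+(1-k)\varepsilon(\alpha(x)))\odot x=k(y\odot x)+(1-k)x$ for all $k\in K$ and $x,y\in V$ with $\alpha(x)=\beta(y)$. Morphisms: a groupoid morphism $(f,f_0):(G,G_0)\to(G',G_0')$ is a pair of maps $f:G\to G'$, $f_0:G_0\to G_0'$ with $\alpha'\circ f=f_0\circ\alpha$, $\beta'\circ f=f_0\circ\beta$ and $f(m(x,y))=m'(f(x),f(y))$ for all $(x,y)\in G_{(2)}$. A vector groupoid morphism between generalized vector groupoids is a groupoid morphism $(f,f_0)$ with $f$ and $f_0$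 linear. If both have the same base $X$ and $f_0=\mathrm{Id}_X$, then $f$ is called an $X$-morphism of vector groupoids. Induced vector groupoid: for $(V,\alpha,\beta,\odot_V,\varepsilon,i,V_0)$ and a linear map $h:X\to V_0$, it is the generalized vector groupoid with base $X$ and total space $h^*(V)=\{(x,y,a)\in X\times X\times V\mid h(x)=\alpha(a),\ h(y)=\beta(a)\}$ (a linear subspace of $X\times X\times V$), with $\alpha^*(x,y,a)=x$, $\beta^*(x,y,a)=y$, $i^*(x,y,a)=(y,x,i(a))$, $\varepsilon^*(x)=(x,x,\varepsilon(h(x)))$, and $(x,y,a)\odot_{h^*(V)}(y,z,b)=(x,z,a\odot_V b)$ defined when $(a,b)\in V_{(2)}$. *)

theory Defs
  imports "HOL-Analysis.Product_Vector" "HOL-Library.FuncSet"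
begin

section \<open>Ehresmann groupoids\<close>

text \<open>
  Groupoids live on carrier sets inside their types.  \<open>comp\<close> is a total function, but it is only
  meaningful on the set \<open>composable\<close>; nothing is assumed about its values elsewhere.
  Composition is written in diagrammatic order:
  \<open>comp G x y\<close> requires \<open>tgt G x = src G y\<close>.
\<close>

record ('g, 'o) groupoid =
  arrows :: "'g set"
  objects :: "'o set"
  src :: "'g \<Rightarrow> 'o"
  tgt :: "'g \<Rightarrow> 'o"
  comp :: "'g \<Rightarrow> 'g \<Rightarrow> 'g"
  unit :: "'o \<Rightarrow> 'g"
  inver :: "'g \<Rightarrow> 'g"

definition composable :: "('g, 'o) groupoid \<Rightarrow> ('g \<times> 'g) set" where
  "composable G = {(x, y). x \<in> arrows G \<and> y \<in> arrows G \<and> tgt G x = src G y}"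

locale ehresmann_groupoid =
  fixes G :: "('g, 'o) groupoid"
  assumes src_surj: "src G ` arrows G = objects G"
    and tgt_surj: "tgt G ` arrows G = objects G"
    and comp_closed: "(x, y) \<in> composable G \<Longrightarrow> comp G x y \<in> arrows G"
    and unit_closed: "a \<in> objects G \<Longrightarrow> unit G a \<in> arrows G"
    and unit_inj: "inj_on (unit G) (objects G)"
    and inver_closed: "x \<in> arrows G \<Longrightarrow> inver G x \<in> arrows G"
    and assoc_defined: "\<lbrakk>x \<in> arrows G; y \<in> arrows G; z \<in> arrows G\<rbrakk> \<Longrightarrow>
      ((x, y) \<in> composable G \<and> (comp G x y, z) \<in> composable G) \<longleftrightarrow>
      ((y, z) \<in> composable G \<and> (x, comp G y z) \<in> composable G)"
    and assoc: "\<lbrakk>(x, y) \<in> composable G; (comp G x y, z) \<in> composable G\<rbrakk> \<Longrightarrow>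
      comp G (comp G x y) z = comp G x (comp G y z)"
    and unit_src_composable: "x \<in> arrows G \<Longrightarrow> (unit G (src G x), x) \<in> composable G"
    and unit_tgt_composable: "x \<in> arrows G \<Longrightarrow> (x, unit G (tgt G x)) \<in> composable G"
    and unit_src: "x \<in> arrows G \<Longrightarrow> comp G (unit G (src G x)) x = x"
    and unit_tgt: "x \<in> arrows G \<Longrightarrow> comp G x (unit G (tgt G x)) = x"
    and inver_left_composable: "x \<in> arrows G \<Longrightarrow> (inver G x, x) \<in> composable G"
    and inver_right_composable: "x \<in> arrows G \<Longrightarrow> (x, inver G x) \<in> composable G"
    and inver_left: "x \<in> arrows G \<Longrightarrow> comp G (inver G x) x = unit G (tgt G x)"
    and inver_right: "x \<in> arrows G \<Longrightarrow> comp G x (inver G x) = unit G (src G x)"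

definition groupoid_morphism ::
  "('g, 'o) groupoid \<Rightarrow> ('h, 'p) groupoid \<Rightarrow> ('g \<Rightarrow> 'h) \<Rightarrow> ('o \<Rightarrow> 'p) \<Rightarrow> bool" where
  "groupoid_morphism G G' f f0 \<longleftrightarrow>
     ehresmann_groupoid G \<and> ehresmann_groupoid G' \<and>
     f \<in> arrows G \<rightarrow> arrows G' \<and> f0 \<in> objects G \<rightarrow> objects G' \<and>
     (\<forall>x\<in>arrows G. src G' (f x) = f0 (src G x)) \<and>
     (\<forall>x\<in>arrows G. tgt G' (f x) = f0 (tgt G x)) \<and>
     (\<forall>(x, y)\<in>composable G. f (comp G x y) = comp G' (f x) (f y))"


section \<open>Vector spaces and linear maps on carriers\<close>

text \<open>
  A vector space over the field \<open>'k\<close> is a carrier set \<open>S\<close> that is a linear subspace of a type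
  carrying a vector space structure with scalar multiplication \<open>s\<close>.  Carriers are needed because
  the total space of the induced groupoid is a proper subspace of a product;
  the case \<open>S = UNIV\<close> is that of a whole type.
\<close>

definition vector_space_on :: "('k::field \<Rightarrow> 'v::ab_group_add \<Rightarrow> 'v) \<Rightarrow> 'v set \<Rightarrow> bool" where
  "vector_space_on s S \<longleftrightarrow> vector_space s \<and> module.subspace s S"

definition linear_map_on ::
  "('k::field \<Rightarrow> 'v::ab_group_add \<Rightarrow> 'v) \<Rightarrow> ('k \<Rightarrow> 'w::ab_group_add \<Rightarrow> 'w) \<Rightarrow>
   'v set \<Rightarrow> 'w set \<Rightarrow> ('v \<Rightarrow> 'w) \<Rightarrow> bool" where
  "linear_map_on s t S T f \<longleftrightarrow>
     f \<in> S \<rightarrow> T \<and>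
     (\<forall>x\<in>S. \<forall>y\<in>S. f (x + y) = f x + f y) \<and>
     (\<forall>k. \<forall>x\<in>S. f (s k x) = t k (f x))"


section \<open>Generalized vector groupoids\<close>

locale generalized_vector_groupoid = ehresmann_groupoid V
  for s :: "'k::field \<Rightarrow> 'v::ab_group_add \<Rightarrow> 'v" (infixr \<open>*s\<close> 75)
    and s0 :: "'k \<Rightarrow> 'o::ab_group_add \<Rightarrow> 'o"
    and V :: "('v, 'o) groupoid" +
  assumes vector_space_arrows: "vector_space_on s (arrows V)"
    and vector_space_objects: "vector_space_on s0 (objects V)"
    and src_linear: "linear_map_on s s0 (arrows V) (objects V) (src V)"
    and tgt_linear: "linear_map_on s s0 (arrows V) (objects V) (tgt V)"
    and unit_linear: "linear_map_on s0 s (objects V) (arrows V) (unit V)"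
    and inver_linear: "linear_map_on s s (arrows V) (arrows V) (inver V)"
    and add_inver: "x \<in> arrows V \<Longrightarrow> x + inver V x = unit V (src V x) + unit V (tgt V x)"
    and comp_add_right:
      "\<lbrakk>x \<in> arrows V; y \<in> arrows V; z \<in> arrows V; src V y = tgt V x; tgt V x = src V z\<rbrakk> \<Longrightarrow>
       comp V x (y + z - unit V (tgt V x)) = comp V x y + comp V x z - x"
    and comp_scale_right:
      "\<lbrakk>x \<in> arrows V; y \<in> arrows V; src V y = tgt V x\<rbrakk> \<Longrightarrow>
       comp V x (k *s y + (1 - k) *s unit V (tgt V x)) = k *s comp V x y + (1 - k) *s x"
    and comp_add_left:
      "\<lbrakk>x \<in> arrows V; y \<in> arrows V; z \<in> arrows V; src V x = tgt V y; tgt V y = tgt V z\<rbrakk> \<Longrightarrow>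
       comp V (y + z - unit V (src V x)) x = comp V y x + comp V z x - x"
    and comp_scale_left:
      "\<lbrakk>x \<in> arrows V; y \<in> arrows V; src V x = tgt V y\<rbrakk> \<Longrightarrow>
       comp V (k *s y + (1 - k) *s unit V (src V x)) x = k *s comp V y x + (1 - k) *s x"

definition vector_groupoid_morphism ::
  "('k::field \<Rightarrow> 'v::ab_group_add \<Rightarrow> 'v) \<Rightarrow> ('k \<Rightarrow> 'o::ab_group_add \<Rightarrow> 'o) \<Rightarrow> ('v, 'o) groupoid \<Rightarrow>
   ('k \<Rightarrow> 'w::ab_group_add \<Rightarrow> 'w) \<Rightarrow> ('k \<Rightarrow> 'p::ab_group_add \<Rightarrow> 'p) \<Rightarrow> ('w, 'p) groupoid \<Rightarrow>
   ('v \<Rightarrow> 'w) \<Rightarrow> ('o \<Rightarrow> 'p) \<Rightarrow> bool" where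
  "vector_groupoid_morphism s s0 V t t0 W f f0 \<longleftrightarrow>
     generalized_vector_groupoid s s0 V \<and> generalized_vector_groupoid t t0 W \<and>
     groupoid_morphism V W f f0 \<and>
     linear_map_on s t (arrows V) (arrows W) f \<and>
     linear_map_on s0 t0 (objects V) (objects W) f0"

text \<open>Both groupoids have base \<open>X\<close>, with the same scalar multiplication \<open>sX\<close>.\<close>

definition base_morphism ::
  "('k::field \<Rightarrow> 'x::ab_group_add \<Rightarrow> 'x) \<Rightarrow> 'x set \<Rightarrow>
   ('k \<Rightarrow> 'v::ab_group_add \<Rightarrow> 'v) \<Rightarrow> ('v, 'x) groupoid \<Rightarrow>
   ('k \<Rightarrow> 'w::ab_group_add \<Rightarrow> 'w) \<Rightarrow> ('w, 'x) groupoid \<Rightarrow> ('v \<Rightarrow> 'w) \<Rightarrow> bool" where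
  "base_morphism sX X s V t W f \<longleftrightarrow>
     objects V = X \<and> objects W = X \<and> vector_groupoid_morphism s sX V t sX W f id"


section \<open>The induced vector groupoid\<close>

definition induced_groupoid ::
  "'x set \<Rightarrow> ('x \<Rightarrow> 'o) \<Rightarrow> ('v, 'o) groupoid \<Rightarrow> ('x \<times> 'x \<times> 'v, 'x) groupoid" where
  "induced_groupoid X h V =
     \<lparr>arrows = {(x, y, a). x \<in> X \<and> y \<in> X \<and> a \<in> arrows V \<and> h x = src V a \<and> h y = tgt V a},
      objects = X,
      src = (\<lambda>(x, y, a). x),
      tgt = (\<lambda>(x, y, a). y),
      comp = (\<lambda>(x, y, a) (y', z, b). (x, z, comp V a b)),
      unit = (\<lambda>x. (x, x, unit V (h x))),
      inver = (\<lambda>(x, y, a). (y, x, inver V a))\<rparr>"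

text \<open>Componentwise scalar multiplication on \<open>X \<times> X \<times> V\<close>; addition is that of the product type.\<close>

abbreviation induced_scale ::
  "('k::field \<Rightarrow> 'x::ab_group_add \<Rightarrow> 'x) \<Rightarrow> ('k \<Rightarrow> 'v::ab_group_add \<Rightarrow> 'v) \<Rightarrow>
   'k \<Rightarrow> 'x \<times> 'x \<times> 'v \<Rightarrow> 'x \<times> 'x \<times> 'v" where
  "induced_scale sX s \<equiv> module_prod.scale sX (module_prod.scale sX s)"

definition induced_proj :: "'x \<times> 'x \<times> 'v \<Rightarrow> 'v" where
  "induced_proj = (\<lambda>(x, y, a). a)"

end

theory Submission
  imports Defs
begin

text \<open>
  The conditions \<open>\<alpha>* \<circ> v = \<alpha>'\<close>, \<open>\<beta>* \<circ> v = \<beta>'\<close> on an \<open>X\<close>-morphism together with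
  \<open>h_V* \<circ> v = u\<close> determine all three components of \<open>v\<close>, so \<open>v w = (\<alpha>' w, \<beta>' w, u w)\<close>
  is the only candidate.  It lands in the induced groupoid because \<open>(u, h)\<close> commutes
  with sources and targets.
\<close>

section \<open>End points in Ehresmann groupoids, and the induced groupoid\<close>

context ehresmann_groupoid
begin

lemma src_closed: "x \<in> arrows G \<Longrightarrow> src G x \<in> objects G"
  using src_surj by blast

lemma tgt_closed: "x \<in> arrows G \<Longrightarrow> tgt G x \<in> objects G"
  using tgt_surj by blast

text \<open>Surjectivity of \<open>src\<close> makes \<open>a\<close> the source of some arrow, and
  the unit at \<open>a\<close> is composable with that arrow. Surjectivity of \<open>tgt\<close>
  serves \<open>src_of_unit\<close> in the same way.\<close>

lemma tgt_of_unit: "a \<in> objects G \<Longrightarrow> tgt G (unit G a) = a"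
  using unit_src_composable unfolding src_surj[symmetric] composable_def by auto

lemma src_of_unit: "a \<in> objects G \<Longrightarrow> src G (unit G a) = a"
  using unit_tgt_composable unfolding tgt_surj[symmetric] composable_def by auto

lemma src_of_inver: "x \<in> arrows G \<Longrightarrow> src G (inver G x) = tgt G x"
  using inver_right_composable by (auto simp: composable_def)

lemma tgt_of_inver: "x \<in> arrows G \<Longrightarrow> tgt G (inver G x) = src G x"
  using inver_left_composable by (auto simp: composable_def)

text \<open>
  The end points of a product are not postulated; they come from the definedness part of
  associativity, applied to \<open>x\<close>, \<open>y\<close> and a unit.
\<close>

lemma src_of_comp:
  assumes "(x, y) \<in> composable G"
  shows "src G (comp G x y) = src G x"
proof -
  let ?e = "unit G (src G x)"
  have x: "x \<in> arrows G" and y: "y \<in> arrows G"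
    using assms by (auto simp: composable_def)
  have e: "?e \<in> arrows G"
    using x src_closed unit_closed by blast
  have "(?e, comp G x y) \<in> composable G"
    using assoc_defined[OF e x y] unit_src_composable[OF x] unit_src[OF x] assms by simp
  then show ?thesis
    using tgt_of_unit[OF src_closed[OF x]] by (simp add: composable_def)
qed

lemma tgt_of_comp:
  assumes "(x, y) \<in> composable G"
  shows "tgt G (comp G x y) = tgt G y"
proof -
  let ?e = "unit G (tgt G y)"
  have x: "x \<in> arrows G" and y: "y \<in> arrows G"
    using assms by (auto simp: composable_def)
  have e: "?e \<in> arrows G"
    using y tgt_closed unit_closed by blast
  have "(comp G x y, ?e) \<in> composable G"
    using assoc_defined[OF x y e] unit_tgt_composable[OF y] unit_tgt[OF y] assms by simp
  then show ?thesis
    using src_of_unit[OF tgt_closed[OF y]] by (simp add: composable_def)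
qed

lemma ehresmann_groupoid_induced:
  assumes h: "\<And>x. x \<in> X \<Longrightarrow> h x \<in> objects G"
  shows "ehresmann_groupoid (induced_groupoid X h G)"
proof
  \<comment> \<open>Unit triples witness surjectivity of source and target over all of
    \<open>X\<close>, whether or not \<open>h\<close> is onto.\<close>
  have *: "(x, x, unit G (h x)) \<in> arrows (induced_groupoid X h G)" if "x \<in> X" for x
    using that by (auto simp: induced_groupoid_def h unit_closed src_of_unit tgt_of_unit)
  show "src (induced_groupoid X h G) ` arrows (induced_groupoid X h G)
      = objects (induced_groupoid X h G)"
    using * by (force simp: induced_groupoid_def image_iff)
  show "tgt (induced_groupoid X h G) ` arrows (induced_groupoid X h G)
      = objects (induced_groupoid X h G)"
    using * by (force simp: induced_groupoid_def image_iff)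
  \<comment> \<open>The first component of a unit triple is its object, so units stay distinct even
    where \<open>h\<close> identifies objects.\<close>
  show "inj_on (unit (induced_groupoid X h G)) (objects (induced_groupoid X h G))"
    by (auto simp: induced_groupoid_def inj_on_def)
qed (auto simp: induced_groupoid_def composable_def h src_closed tgt_closed unit_closed
    inver_closed src_of_unit tgt_of_unit src_of_inver tgt_of_inver unit_src unit_tgt
    inver_left inver_right comp_closed[unfolded composable_def]
    src_of_comp[unfolded composable_def] tgt_of_comp[unfolded composable_def]
    assoc[unfolded composable_def])

end

section \<open>Linear structure of the induced groupoid\<close>

lemma linear_map_onD:
  assumes "linear_map_on s t S T f"
  shows "x \<in> S \<Longrightarrow> f x \<in> T"
    and "\<lbrakk>x \<in> S; y \<in> S\<rbrakk> \<Longrightarrow> f (x + y) = f x + f y"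
    and "x \<in> S \<Longrightarrow> f (s k x) = t k (f x)"
  using assms by (auto simp: linear_map_on_def)

text \<open>The last clause serves the scaling laws of the induced groupoid: there the outer end
  point of the fixed factor occurs in both terms of the combination and has to come out
  unchanged.\<close>

lemma vector_space_onD:
  assumes "vector_space_on s S"
  shows "vector_space s"
    and "0 \<in> S"
    and "\<lbrakk>x \<in> S; y \<in> S\<rbrakk> \<Longrightarrow> x + y \<in> S"
    and "x \<in> S \<Longrightarrow> s k x \<in> S"
    and "x \<in> S \<Longrightarrow> s k x + s (1 - k) x = x"
proof -
  show s: "vector_space s"
    using assms by (simp add: vector_space_on_def)
  interpret vector_space s by (fact s)
  have "subspace S"
    using assms by (simp add: vector_space_on_def)
  then show "0 \<in> S" "\<lbrakk>x \<in> S; y \<in> S\<rbrakk> \<Longrightarrow> x + y \<in> S" "x \<in> S \<Longrightarrow> s k x \<in> S"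
    by (auto simp: subspace_def)
  show "s k x + s (1 - k) x = x"
    by (simp flip: scale_left_distrib)
qed

lemma linear_map_on_zero:
  assumes "linear_map_on s t S T f" "vector_space_on s S"
  shows "f 0 = 0"
  using linear_map_onD(2)[OF assms(1), of 0 0] vector_space_onD(2)[OF assms(2)] by simp

text \<open>The defining equation of \<open>module_prod.scale\<close> is available only inside its
  locale, so the product is interpreted twice, for the inner and for the outer pair.\<close>

lemma induced_scale_apply:
  assumes "vector_space sX" "vector_space s"
  shows "induced_scale sX s k (x, y, a) = (sX k x, sX k y, s k a)"
proof -
  interpret X: vector_space sX by fact
  interpret S: vector_space s by fact
  interpret XS: vector_space_prod sX s ..
  interpret XXS: vector_space_prod sX XS.scale ..
  show ?thesis by (simp add: XXS.scale_def XS.scale_def)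
qed

lemma vector_space_induced_scale:
  assumes "vector_space sX" "vector_space s"
  shows "vector_space (induced_scale sX s)"
proof -
  interpret X: vector_space sX by fact
  interpret S: vector_space s by fact
  interpret XS: vector_space_prod sX s ..
  interpret XXS: vector_space_prod sX XS.scale ..
  show ?thesis by (rule XXS.p.vector_space_axioms)
qed

lemma (in generalized_vector_groupoid) generalized_vector_groupoid_induced:
  assumes X: "vector_space_on sX X"
    and h: "linear_map_on sX s0 X (objects V) h"
  shows "generalized_vector_groupoid (induced_scale sX s) sX (induced_groupoid X h V)"
proof -
  note vs = vector_space_onD(1)[OF X] vector_space_onD(1)[OF vector_space_arrows]
  note scale = induced_scale_apply[OF vs]
  note lin = linear_map_onD[OF h] linear_map_onD[OF src_linear] linear_map_onD[OF tgt_linear]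
    linear_map_onD[OF unit_linear] linear_map_onD[OF inver_linear]
  note zero = linear_map_on_zero[OF h X]
    linear_map_on_zero[OF src_linear vector_space_arrows]
    linear_map_on_zero[OF tgt_linear vector_space_arrows]
  note closed = vector_space_onD(2-4)[OF X] vector_space_onD(2-4)[OF vector_space_arrows]
  note convex = vector_space_onD(5)[OF X]
  \<comment> \<open>The carrier is the solution set of the linear equations
    \<open>h x = src V a\<close> and \<open>h y = tgt V a\<close>.\<close>
  have subspace: "module.subspace (induced_scale sX s) (arrows (induced_groupoid X h V))"
  proof -
    interpret vector_space "induced_scale sX s"
      by (rule vector_space_induced_scale[OF vs])
    show ?thesis
      by (auto simp: subspace_def induced_groupoid_def zero_prod_def scale lin zero closed)
  qed
  \<comment> \<open>With this interpretation in place, unfolding the locale below leaves only the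
    linear axioms.\<close>
  interpret I: ehresmann_groupoid "induced_groupoid X h V"
    using linear_map_onD(1)[OF h] by (rule ehresmann_groupoid_induced)
  show ?thesis
  proof
    show "vector_space_on (induced_scale sX s) (arrows (induced_groupoid X h V))"
      using subspace vector_space_induced_scale[OF vs] by (simp add: vector_space_on_def)
    show "vector_space_on sX (objects (induced_groupoid X h V))"
      using X by (simp add: induced_groupoid_def)
    show "linear_map_on (induced_scale sX s) sX (arrows (induced_groupoid X h V))
        (objects (induced_groupoid X h V)) (src (induced_groupoid X h V))"
      by (auto simp: linear_map_on_def induced_groupoid_def scale)
    show "linear_map_on (induced_scale sX s) sX (arrows (induced_groupoid X h V))
        (objects (induced_groupoid X h V)) (tgt (induced_groupoid X h V))"
      by (auto simp: linear_map_on_def induced_groupoid_def scale)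
    show "linear_map_on sX (induced_scale sX s) (objects (induced_groupoid X h V))
        (arrows (induced_groupoid X h V)) (unit (induced_groupoid X h V))"
      using I.unit_closed
      by (auto simp: linear_map_on_def induced_groupoid_def scale lin)
    show "linear_map_on (induced_scale sX s) (induced_scale sX s)
        (arrows (induced_groupoid X h V)) (arrows (induced_groupoid X h V))
        (inver (induced_groupoid X h V))"
      using I.inver_closed
      by (auto simp: linear_map_on_def induced_groupoid_def scale lin)
  \<comment> \<open>In the last component each remaining law is the law of \<open>V\<close>, since
    membership in the carrier turns \<open>unit V (h y)\<close> into
    \<open>unit V (tgt V a)\<close>, and likewise for sources. The end-point components are
    identities in \<open>X\<close>.\<close>
  qed (auto simp: induced_groupoid_def scale convex add_inver comp_add_right comp_scale_right
      comp_add_left comp_scale_left)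
qed

section \<open>The universal property\<close>

lemma induced_universal_map_morphism:
  assumes V: "generalized_vector_groupoid s s0 V"
    and X: "vector_space_on sX X"
    and h: "linear_map_on sX s0 X (objects V) h"
    and V': "generalized_vector_groupoid s' sX V'"
    and obj: "objects V' = X"
    and u: "vector_groupoid_morphism s' sX V' s s0 V u h"
  shows "base_morphism sX X s' V' (induced_scale sX s) (induced_groupoid X h V)
    (\<lambda>w\<in>arrows V'. (src V' w, tgt V' w, u w))"
proof -
  interpret V: generalized_vector_groupoid s s0 V by fact
  interpret V': generalized_vector_groupoid s' sX V' by fact
  interpret I: generalized_vector_groupoid "induced_scale sX s" sX "induced_groupoid X h V"
    by (rule V.generalized_vector_groupoid_induced[OF X h])
  note scale = induced_scale_apply[OF vector_space_onD(1)[OF X]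
      vector_space_onD(1)[OF V.vector_space_arrows]]
  have um: "u w \<in> arrows V" "src V (u w) = h (src V' w)" "tgt V (u w) = h (tgt V' w)"
    if "w \<in> arrows V'" for w
    using u that by (auto simp: vector_groupoid_morphism_def groupoid_morphism_def)
  have uc: "u (comp V' x y) = comp V (u x) (u y)" if "(x, y) \<in> composable V'" for x y
    using u that by (auto simp: vector_groupoid_morphism_def groupoid_morphism_def)
  have ul: "linear_map_on s' s (arrows V') (arrows V) u"
    using u by (simp add: vector_groupoid_morphism_def)
  let ?v = "\<lambda>w\<in>arrows V'. (src V' w, tgt V' w, u w)"
  have v: "?v \<in> arrows V' \<rightarrow> arrows (induced_groupoid X h V)"
    using um V'.src_closed V'.tgt_closed by (auto simp: induced_groupoid_def obj)
  have "groupoid_morphism V' (induced_groupoid X h V) ?v id"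
    unfolding groupoid_morphism_def
    using V'.ehresmann_groupoid_axioms I.ehresmann_groupoid_axioms v
    \<comment> \<open>\<open>composable V'\<close> stays folded at first, because closure, the
      end-point laws and \<open>uc\<close> have it as their premise.\<close>
    by (auto simp: V'.comp_closed V'.src_of_comp V'.tgt_of_comp uc)
      (auto simp: induced_groupoid_def obj composable_def)
  moreover have "linear_map_on s' (induced_scale sX s) (arrows V')
      (arrows (induced_groupoid X h V)) ?v"
    unfolding linear_map_on_def
    \<comment> \<open>Closure under sums and multiples allows the restricted map to be evaluated at
      them.\<close>
    using v vector_space_onD(3,4)[OF V'.vector_space_arrows]
    by (simp add: scale linear_map_onD[OF ul] linear_map_onD[OF V'.src_linear]
        linear_map_onD[OF V'.tgt_linear])
  moreover have "objects (induced_groupoid X h V) = X"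
    by (simp add: induced_groupoid_def)
  moreover have "linear_map_on sX sX X X id"
    by (simp add: linear_map_on_def)
  ultimately show ?thesis
    using obj V'.generalized_vector_groupoid_axioms I.generalized_vector_groupoid_axioms
    by (simp add: base_morphism_def vector_groupoid_morphism_def)
qed

lemma base_morphism_into_induced_unique:
  assumes v: "base_morphism sX X s' V' t (induced_groupoid X h V) v"
    and p: "induced_proj (v w) = u w"
    and w: "w \<in> arrows V'"
  shows "v w = (src V' w, tgt V' w, u w)"
proof -
  have "src (induced_groupoid X h V) (v w) = src V' w"
    "tgt (induced_groupoid X h V) (v w) = tgt V' w"
    using v w by (auto simp: base_morphism_def vector_groupoid_morphism_def groupoid_morphism_def)
  then show ?thesis
    using p by (cases "v w") (simp add: induced_groupoid_def induced_proj_def)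
qed

theorem theorem4p1:
  fixes s :: "'k::field \<Rightarrow> 'v::ab_group_add \<Rightarrow> 'v"
    and s0 :: "'k \<Rightarrow> 'o::ab_group_add \<Rightarrow> 'o"
    and V :: "('v, 'o) groupoid"
    and sX :: "'k \<Rightarrow> 'x::ab_group_add \<Rightarrow> 'x"
    and X :: "'x set"
    and h :: "'x \<Rightarrow> 'o"
    and s' :: "'k \<Rightarrow> 'w::ab_group_add \<Rightarrow> 'w"
    and V' :: "('w, 'x) groupoid"
    and u :: "'w \<Rightarrow> 'v"
  assumes "generalized_vector_groupoid s s0 V"
    and "vector_space_on sX X"
    and "linear_map_on sX s0 X (objects V) h"
    and "generalized_vector_groupoid s' sX V'"
    and "objects V' = X"
    and "vector_groupoid_morphism s' sX V' s s0 V u h"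
  shows "\<exists>!v. v \<in> extensional (arrows V') \<and>
           base_morphism sX X s' V' (induced_scale sX s) (induced_groupoid X h V) v \<and>
           (\<forall>w\<in>arrows V'. induced_proj (v w) = u w)"
proof (rule ex1I)
  \<comment> \<open>Morphism conditions say nothing about values outside \<open>arrows V'\<close>.
    Extensionality fixes these values, so the candidate is a restricted function and agreement on
    arrows gives equality.\<close>
  let ?v = "\<lambda>w\<in>arrows V'. (src V' w, tgt V' w, u w)"
  show "?v \<in> extensional (arrows V') \<and>
      base_morphism sX X s' V' (induced_scale sX s) (induced_groupoid X h V) ?v \<and>
      (\<forall>w\<in>arrows V'. induced_proj (?v w) = u w)"
    using induced_universal_map_morphism[OF assms] by (simp add: induced_proj_def)
  show "v = ?v" if "v \<in> extensional (arrows V') \<and>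
      base_morphism sX X s' V' (induced_scale sX s) (induced_groupoid X h V) v \<and>
      (\<forall>w\<in>arrows V'. induced_proj (v w) = u w)" for v
    using that
    by (intro extensionalityI[of v "arrows V'"]) (auto intro: base_morphism_into_induced_unique)
qed

end
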